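(* Let $I\subset\mathbb{R}$ be an open interval, let $\gamma:I\to\mathbb{R}^2\setminus\{0\}$ be a smooth unit speed curve with unit normal $n$ such that $\langle n(s),\gamma(s)\rangle\neq0$ for all $s\in I$, and let $r\in\mathbb{R}\setminus\{0\}$. Then for all $s\in I$ $$r\text{-}\mathrm{Pr}_\gamma(s)=r\,\mathrm{Pr}_\gamma(s)=\mathrm{Pr}_{r\gamma}(s).$$
   Context: $J=\begin{pmatrix}0&-1\\1&0\end{pmatrix}$. For a regular curve $c$ (not necessarily unit speed), $t_c=c'/\|c'\|$ and $n_c=Jt_c$. $r$-parallel primitivoid: $r\text{-}\mathrm{Pr}_\gamma$ is the envelope of the family of lines through $r\gamma(s)$ orthogonal to $\gamma(s)$; that is, with $H(s,x)=\langle x-r\gamma(s),\gamma(s)\rangle$, $r\text{-}\mathrm{Pr}_\gamma(s)$ is the unique point $x\in\mathbb{R}^2$ with $H(s,x)=\frac{\partial H}{\partial s}(s,x)=0$. Primitive: for a regular curve $c:I\to\mathbb{R}^2\setminus\{0\}$ with $\langle c,n_c\rangle\ne0$, $\mathrm{Pr}_c$ is the envelope of the lines $\{x:\langle x-c(s),c(s)\rangle=0\}_{s\in I}$, explicitly $\mathrm{Pr}_c(s)=2c(s)-\frac{\|c(s)\|^2}{\langle n_c(s),c(s)\rangle}n_c(s)$. *)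

theory Defs
  imports "HOL-Analysis.Analysis"
begin

definition J :: "real^2^2" where
  "J = vector [vector [0, -1], vector [1, 0]]"

(* All iterated derivatives exist on S. The derivatives are two-sided, so this is the usual notion
   of smoothness only for open S; the values of c outside S play no role then. *)
definition smooth_curve_on :: "real set \<Rightarrow> (real \<Rightarrow> real^2) \<Rightarrow> bool" where
  "smooth_curve_on S c \<longleftrightarrow>
     (\<forall>k. \<forall>s\<in>S. ((\<lambda>f t. vector_derivative f (at t)) ^^ k) c differentiable (at s))"

definition unit_tangent :: "(real \<Rightarrow> real^2) \<Rightarrow> real \<Rightarrow> real^2" where
  "unit_tangent c s =
     (1 / norm (vector_derivative c (at s))) *\<^sub>R vector_derivative c (at s)"

definition unit_normal :: "(real \<Rightarrow> real^2) \<Rightarrow> real \<Rightarrow> real^2" where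
  "unit_normal c s = J *v unit_tangent c s"

(* has_real_derivative 0 rather than deriv = 0: deriv is unspecified where F(.,x) is not
   differentiable. *)
definition envelope_point :: "(real \<Rightarrow> real^2 \<Rightarrow> real) \<Rightarrow> real \<Rightarrow> real^2 \<Rightarrow> bool" where
  "envelope_point F s x \<longleftrightarrow> F s x = 0 \<and> ((\<lambda>u. F u x) has_real_derivative 0) (at s)"

definition parallel_primitivoid :: "real \<Rightarrow> (real \<Rightarrow> real^2) \<Rightarrow> real \<Rightarrow> real^2" where
  "parallel_primitivoid r c s =
     (THE x. envelope_point (\<lambda>u x. (x - r *\<^sub>R c u) \<bullet> c u) s x)"

(* The explicit form; the lemma envelope_point_iff_primitive below identifies it with the envelope
   of the lines through c(s) orthogonal to c(s). *)
definition primitive :: "(real \<Rightarrow> real^2) \<Rightarrow> real \<Rightarrow> real^2" where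
  "primitive c s =
     2 *\<^sub>R c s - ((norm (c s))\<^sup>2 / (unit_normal c s \<bullet> c s)) *\<^sub>R unit_normal c s"

lemma envelope_point_iff_primitive:
  assumes diff: "c differentiable (at s)"
    and regular: "vector_derivative c (at s) \<noteq> 0"
    and transversal: "c s \<bullet> unit_normal c s \<noteq> 0"
  shows "envelope_point (\<lambda>u x. (x - c u) \<bullet> c u) s x \<longleftrightarrow> x = primitive c s"
proof -
  define v where "v = vector_derivative c (at s)"
  define m where "m = norm v"
  define a b p q where "a = c s $ 1" and "b = c s $ 2" and "p = v $ 1" and "q = v $ 2"
  have m: "m > 0" using regular by (simp add: m_def v_def)
  have c': "(c has_vector_derivative v) (at s)"
    using diff by (simp add: v_def vector_derivative_works)
  have "((\<lambda>u. (x - c u) \<bullet> c u) has_real_derivative ((x - c s) \<bullet> v + (0 - v) \<bullet> c s)) (at s)"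
    unfolding has_real_derivative_iff_has_vector_derivative
    by (rule bounded_bilinear.has_vector_derivative[OF bounded_bilinear_inner])
       (auto intro!: derivative_eq_intros c')
  then have D: "((\<lambda>u. (x - c u) \<bullet> c u) has_real_derivative 0) (at s) \<longleftrightarrow>
      (x - c s) \<bullet> v + (0 - v) \<bullet> c s = 0"
    by (metis DERIV_unique)
  have n: "unit_normal c s $ 1 = - q / m" "unit_normal c s $ 2 = p / m"
    by (simp_all add: unit_normal_def unit_tangent_def J_def matrix_vector_mult_def
        sum_2 p_def q_def m_def v_def)
  have d: "unit_normal c s \<bullet> c s = (b * p - a * q) / m"
    by (simp add: inner_vec_def sum_2 n a_def b_def diff_divide_distrib mult.commute)
  have dn: "b * p - a * q \<noteq> 0"
    using transversal d by (auto simp: inner_commute)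
  have nn: "(norm (c s))\<^sup>2 = a * a + b * b"
    by (simp add: power2_norm_eq_inner inner_vec_def sum_2 a_def b_def)
  have P: "primitive c s $ 1 = 2 * a + (a * a + b * b) * q / (b * p - a * q)"
    "primitive c s $ 2 = 2 * b - (a * a + b * b) * p / (b * p - a * q)"
    using m by (simp_all add: primitive_def d n nn a_def b_def)
  have E: "envelope_point (\<lambda>u x. (x - c u) \<bullet> c u) s x \<longleftrightarrow>
      (x$1 - a) * a + (x$2 - b) * b = 0 \<and> (x$1 - 2 * a) * p + (x$2 - 2 * b) * q = 0"
    unfolding envelope_point_def D
    by (simp add: inner_vec_def sum_2 a_def b_def p_def q_def algebra_simps)
  have X: "x = primitive c s \<longleftrightarrow> x$1 = primitive c s $ 1 \<and> x$2 = primitive c s $ 2"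
    by (simp add: vec_eq_iff forall_2)
  have S: "x$1 = primitive c s $ 1 \<longleftrightarrow>
      x$1 * (b * p - a * q) = 2 * a * (b * p - a * q) + (a * a + b * b) * q"
    "x$2 = primitive c s $ 2 \<longleftrightarrow>
      x$2 * (b * p - a * q) = 2 * b * (b * p - a * q) - (a * a + b * b) * p"
    using dn by (simp_all add: P divide_simps add_divide_eq_iff diff_divide_eq_iff)
  show ?thesis
    unfolding E X S
  proof (intro iffI conjI; elim conjE)
    assume A: "(x$1 - a) * a + (x$2 - b) * b = 0" "(x$1 - 2 * a) * p + (x$2 - 2 * b) * q = 0"
    show "x$1 * (b * p - a * q) = 2 * a * (b * p - a * q) + (a * a + b * b) * q"
      using A by algebra
    show "x$2 * (b * p - a * q) = 2 * b * (b * p - a * q) - (a * a + b * b) * p"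
      using A by algebra
  next
    assume A: "x$1 * (b * p - a * q) = 2 * a * (b * p - a * q) + (a * a + b * b) * q"
      "x$2 * (b * p - a * q) = 2 * b * (b * p - a * q) - (a * a + b * b) * p"
    have "((x$1 - a) * a + (x$2 - b) * b) * (b * p - a * q) = 0"
      using A by algebra
    then show "(x$1 - a) * a + (x$2 - b) * b = 0" using dn by simp
    have "((x$1 - 2 * a) * p + (x$2 - 2 * b) * q) * (b * p - a * q) = 0"
      using A by algebra
    then show "(x$1 - 2 * a) * p + (x$2 - 2 * b) * q = 0" using dn by simp
  qed
qed

end

theory Submission
  imports Defs
begin

text \<open>Since \<open>(x - r c) \<bullet> c = r ((x/r - c) \<bullet> c)\<close>, the homothety of
  ratio \<open>r\<close> carries the family of lines defining the primitive to the one defining the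
  \<open>r\<close>-parallel primitivoid, hence envelope to envelope
  (\<open>envelope_point_scaleR_iff\<close>). With \<open>envelope_point_iff_primitive\<close> this
  gives the first equality. The second is homogeneity of the explicit formula
  (\<open>primitive_scaleR\<close>).\<close>

lemma envelope_point_scaleR_iff:
  assumes "r \<noteq> 0"
  shows "envelope_point (\<lambda>u x. (x - r *\<^sub>R c u) \<bullet> c u) s x \<longleftrightarrow>
    envelope_point (\<lambda>u x. (x - c u) \<bullet> c u) s (x /\<^sub>R r)"
proof -
  \<comment> \<open>The factor \<open>r\<close> is nonzero and independent of \<open>u\<close>, so
    it affects neither the vanishing of the function nor that of its
    \<open>u\<close>-derivative.\<close>
  have eq: "(x - r *\<^sub>R c u) \<bullet> c u = r * ((x /\<^sub>R r - c u) \<bullet> c u)" for u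
    using assms by (simp add: inner_diff_left right_diff_distrib)
  have "((\<lambda>u. r * ((x /\<^sub>R r - c u) \<bullet> c u)) has_real_derivative 0) (at s) \<longleftrightarrow>
      ((\<lambda>u. (x /\<^sub>R r - c u) \<bullet> c u) has_real_derivative 0) (at s)"
    (is "?L \<longleftrightarrow> ?R")
  proof
    assume ?L
    from DERIV_cmult[OF this, of "inverse r"] show ?R
      using assms by (simp flip: mult.assoc)
  next
    assume ?R
    from DERIV_cmult[OF this, of r] show ?L by simp
  qed
  then show ?thesis
    using assms by (simp add: envelope_point_def eq)
qed

text \<open>Normalising \<open>r c'\<close> leaves the factor \<open>r / |r|\<close>, so a negative
  \<open>r\<close> reverses the normal. For \<open>r = 0\<close> both sides are 0.\<close>

lemma unit_normal_scaleR:
  assumes "c differentiable (at s)"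
  shows "unit_normal (\<lambda>u. r *\<^sub>R c u) s = sgn r *\<^sub>R unit_normal c s"
proof -
  have "((\<lambda>u. r *\<^sub>R c u) has_vector_derivative r *\<^sub>R vector_derivative c (at s)) (at s)"
    using assms by (auto intro!: derivative_eq_intros simp: vector_derivative_works)
  then have "vector_derivative (\<lambda>u. r *\<^sub>R c u) (at s) = r *\<^sub>R vector_derivative c (at s)"
    by (rule vector_derivative_at)
  then have "unit_tangent (\<lambda>u. r *\<^sub>R c u) s = sgn r *\<^sub>R unit_tangent c s"
    by (simp add: unit_tangent_def sgn_if)
  then show ?thesis
    by (simp add: unit_normal_def matrix_vector_mult_scaleR)
qed

text \<open>The normal enters the quotient term twice, once in the denominator, so its sign
  \<open>sgn r\<close> cancels; what remains is \<open>r^2 / r = r\<close>.\<close>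

lemma primitive_scaleR:
  assumes "c differentiable (at s)"
  shows "primitive (\<lambda>u. r *\<^sub>R c u) s = r *\<^sub>R primitive c s"
  by (simp add: primitive_def unit_normal_scaleR[OF assms] sgn_if power2_eq_square
      scaleR_diff_right mult.commute mult.left_commute)

lemma parallel_primitivoid_eq_scaleR_primitive:
  assumes "c differentiable (at s)" and "vector_derivative c (at s) \<noteq> 0"
    and "c s \<bullet> unit_normal c s \<noteq> 0" and "r \<noteq> 0"
  shows "parallel_primitivoid r c s = r *\<^sub>R primitive c s"
proof -
  \<comment> \<open>An equivalence for every \<open>x\<close> gives existence and uniqueness at
    once, which is what evaluates the definite description.\<close>
  have "envelope_point (\<lambda>u x. (x - r *\<^sub>R c u) \<bullet> c u) s x \<longleftrightarrow> x = r *\<^sub>R primitive c s" for x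
    unfolding envelope_point_scaleR_iff[OF \<open>r \<noteq> 0\<close>] envelope_point_iff_primitive[OF assms(1-3)]
    using \<open>r \<noteq> 0\<close> by (auto dest: sym)
  then show ?thesis
    by (simp add: parallel_primitivoid_def)
qed

theorem theorem3p1:
  fixes I :: "real set" and \<gamma> :: "real \<Rightarrow> real^2" and r :: real
  assumes "open I" and "is_interval I"
    and "smooth_curve_on I \<gamma>"
    and "\<forall>s\<in>I. \<gamma> s \<noteq> 0"
    and "\<forall>s\<in>I. norm (vector_derivative \<gamma> (at s)) = 1"
    and "\<forall>s\<in>I. unit_normal \<gamma> s \<bullet> \<gamma> s \<noteq> 0"
    and "r \<noteq> 0"
  shows "\<forall>s\<in>I. parallel_primitivoid r \<gamma> s = r *\<^sub>R primitive \<gamma> s \<and>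
               r *\<^sub>R primitive \<gamma> s = primitive (\<lambda>u. r *\<^sub>R \<gamma> u) s"
proof
  fix s assume s: "s \<in> I"
  \<comment> \<open>This is smoothness at \<open>k = 0\<close>, the zeroth iterate being the curve
    itself.\<close>
  have diff: "\<gamma> differentiable (at s)"
    using assms(3) s unfolding smooth_curve_on_def by (metis funpow_0)
  have "vector_derivative \<gamma> (at s) \<noteq> 0"
    using assms(5) s by force
  moreover have "\<gamma> s \<bullet> unit_normal \<gamma> s \<noteq> 0"
    using assms(6) s by (simp add: inner_commute)
  ultimately show "parallel_primitivoid r \<gamma> s = r *\<^sub>R primitive \<gamma> s \<and>
      r *\<^sub>R primitive \<gamma> s = primitive (\<lambda>u. r *\<^sub>R \<gamma> u) s"
    using parallel_primitivoid_eq_scaleR_primitive primitive_scaleR diff \<open>r \<noteq> 0\<close> by simp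
qed

end
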